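(* Let $(X_n)_{n\ge1}$ be independent identically distributed real random variables with negative drift $\mathbb{E}[X_1]<0$, whose common distribution function $F_X$ is absolutely continuous with density $f_X$, and let $B_{n+1}=\max(0,B_n+X_{n+1})$ on the state space $[0,\infty)$. Let $\Pi$ be a stationary law of this process (i.e. $B_n\sim\Pi$ for all $n$), let $G(b)=\Pi([0,b])$ be its distribution function, and suppose $\Pi=p_0\,\delta_0+g(s)\,\mathrm{d}s$ with $p_0=\Pi(\{0\})$ and $g$ a density on $(0,\infty)$. Then $$G(b)=\int_{[0,\infty)}F_X(b-s)\,\Pi(\mathrm{d}s)=p_0F_X(b)+\int_0^\infty F_X(b-s)\,g(s)\,\mathrm{d}s,\qquad b\ge0,$$ $$g(b)=p_0f_X(b)+\int_0^\infty f_X(b-s)\,g(s)\,\mathrm{d}s,\qquad b\in(0,\infty),$$ the latter for Lebesgue-almost every $b>0$, together with the normalization $$1=p_0+\int_0^\infty g(b)\,\mathrm{d}b.$$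
   Context: In the application, $X_n=-Y_n-a$, where $Y_n$ are the increments of the primary power source and $a>0$ is the maximum tolerable drop in grid power per time step; $B_n$ is the battery power. Under stationarity, $X_{n+1}$ is independent of $B_n$. The standing assumption is that the laws involved have no singular continuous part and that the only possible atom is $0$. $\delta_0$ is the Dirac measure at $0$. *)

theory Defs
  imports "HOL-Probability.Probability"
begin

end

theory Submission
  imports Defs
begin

text \<open>Conditioning on the independent pair $(B, X)$ gives
  $\Pi(A) = \int P(\max(0, s + X) \in A)\, \Pi(ds)$ for every Borel set $A$.
  Taking $A = [0,b]$ yields the equation for $G$. For $A \subseteq (0,\infty)$ the truncation is
  irrelevant, so by translation invariance of Lebesgue measure and Tonelli $\Pi$ has the density
  $y \mapsto \int f_X(y - s)\, \Pi(ds)$ on $(0,\infty)$; uniqueness of densities identifies it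
  with $g$.\<close>

text \<open>Passes from sets to nonnegative functions by induction on measurable functions: the
  hypothesis is the indicator case, and linear combinations and increasing limits preserve the
  identity. The assumption is about values on sets because the decomposition of the stationary law
  is given in that form.\<close>

lemma nn_integral_measure_sum:
  assumes sets: "sets N = sets M" "sets P = sets M"
    and emeasure: "\<And>A. A \<in> sets M \<Longrightarrow> emeasure M A = c * emeasure N A + emeasure P A"
    and u: "u \<in> borel_measurable M"
  shows "(\<integral>\<^sup>+x. u x \<partial>M) = c * (\<integral>\<^sup>+x. u x \<partial>N) + (\<integral>\<^sup>+x. u x \<partial>P)"
proof -
  have meas: "v \<in> borel_measurable N" "v \<in> borel_measurable P"
    if "v \<in> borel_measurable M" for v :: "'a \<Rightarrow> ennreal"
    using that by (simp_all add: measurable_cong_sets[OF sets(1) refl] measurable_cong_sets[OF sets(2) refl])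
  show ?thesis
    using u
  proof (induction rule: borel_measurable_induct)
    case (cong f g)
    have "space N = space M" "space P = space M"
      using sets sets_eq_imp_space_eq by blast+
    with cong show ?case
      by (metis (no_types, lifting) nn_integral_cong)
  next
    case (set A)
    then show ?case
      using emeasure sets by simp
  next
    case (mult u a)
    show ?case
      using mult meas[OF mult.hyps(2)] by (simp add: nn_integral_cmult distrib_left ac_simps)
  next
    case (add u v)
    show ?case
      using add meas[OF add.hyps(1)] meas[OF add.hyps(3)] by (simp add: nn_integral_add distrib_left ac_simps)
  next
    case (seq U)
    \<comment> \<open>The supremum of a sum splits into the sum of the suprema because both
      sequences increase in the same index.\<close>
    have inc: "incseq (\<lambda>i. c * integral\<^sup>N N (U i))" "incseq (\<lambda>i. integral\<^sup>N P (U i))"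
      using seq(3) by (auto simp: incseq_def le_fun_def intro!: nn_integral_mono mult_left_mono)
    have "(\<integral>\<^sup>+x. (SUP i. U i) x \<partial>M) = (SUP i. c * integral\<^sup>N N (U i) + integral\<^sup>N P (U i))"
      using seq by (simp add: image_comp nn_integral_monotone_convergence_SUP)
    also have "\<dots> = c * (SUP i. integral\<^sup>N N (U i)) + (SUP i. integral\<^sup>N P (U i))"
      using inc by (simp add: ennreal_SUP_add SUP_mult_left_ennreal)
    also have "\<dots> = c * (\<integral>\<^sup>+x. (SUP i. U i) x \<partial>N) + (\<integral>\<^sup>+x. (SUP i. U i) x \<partial>P)"
      using seq(3) meas[OF seq(1)] by (simp add: image_comp nn_integral_monotone_convergence_SUP)
    finally show ?case .
  qed
qed

lemma nn_integral_atom_plus_density: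
  fixes \<mu> :: "'b :: euclidean_space measure"
  assumes sets: "sets \<mu> = sets borel"
    and emeasure: "\<And>A. A \<in> sets borel \<Longrightarrow>
      emeasure \<mu> A = c * emeasure (return borel a) A + emeasure (density lborel k) A"
    and [measurable]: "k \<in> borel_measurable borel" "u \<in> borel_measurable borel"
  shows "(\<integral>\<^sup>+x. u x \<partial>\<mu>) = c * u a + (\<integral>\<^sup>+x. u x * k x \<partial>lborel)"
proof -
  have "(\<integral>\<^sup>+x. u x \<partial>\<mu>)
      = c * (\<integral>\<^sup>+x. u x \<partial>return borel a) + (\<integral>\<^sup>+x. u x \<partial>density lborel k)"
    by (rule nn_integral_measure_sum)
      (use emeasure in \<open>simp_all add: sets measurable_cong_sets[OF sets refl]\<close>)
  then show ?thesis
    by (simp add: nn_integral_return nn_integral_density mult.commute)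
qed

text \<open>Transfers the \<open>ennreal\<close> identity to Bochner integrals. Finiteness is only
  asked of the integral against \<mu>: the two summands on the other side are nonnegative, so each
  is finite as well, and both integrability claims follow.\<close>

lemma integral_atom_plus_density:
  fixes \<mu> :: "real measure" and u k :: "real \<Rightarrow> real"
  assumes sets: "sets \<mu> = sets borel"
    and emeasure: "\<And>A. A \<in> sets borel \<Longrightarrow> emeasure \<mu> A
      = ennreal p * emeasure (return borel a) A + emeasure (density lborel (\<lambda>s. ennreal (k s))) A"
    and [measurable]: "k \<in> borel_measurable borel" "u \<in> borel_measurable borel"
    and nonneg: "0 \<le> p" "\<And>s. 0 \<le> k s" "\<And>s. 0 \<le> u s"
    and finite: "(\<integral>\<^sup>+x. ennreal (u x) \<partial>\<mu>) < \<infinity>"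
  shows "integrable \<mu> u" and "integrable lborel (\<lambda>s. u s * k s)"
    and "integral\<^sup>L \<mu> u = p * u a + (LINT s|lborel. u s * k s)"
proof -
  have u: "u \<in> borel_measurable \<mu>"
    by (simp add: measurable_cong_sets[OF sets refl])
  have eq: "(\<integral>\<^sup>+x. ennreal (u x) \<partial>\<mu>) = ennreal p * ennreal (u a) + (\<integral>\<^sup>+x. ennreal (u x * k x) \<partial>lborel)"
    using nn_integral_atom_plus_density[OF sets emeasure, of "\<lambda>x. ennreal (u x)"] nonneg
    by (simp add: ennreal_mult)
  show int_u: "integrable \<mu> u"
    using u finite nonneg by (intro integrableI_nonneg) auto
  have "(\<integral>\<^sup>+x. ennreal (u x * k x) \<partial>lborel) < \<infinity>"
    using finite unfolding eq by auto
  then show int_uk: "integrable lborel (\<lambda>s. u s * k s)"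
    using nonneg by (intro integrableI_nonneg) auto
  have "ennreal (integral\<^sup>L \<mu> u) = ennreal (p * u a + (LINT s|lborel. u s * k s))"
    using eq nonneg nn_integral_eq_integral[OF int_u] nn_integral_eq_integral[OF int_uk]
    by (simp add: ennreal_mult[symmetric] del: ennreal_mult)
  moreover have "0 \<le> integral\<^sup>L \<mu> u" "0 \<le> p * u a + (LINT s|lborel. u s * k s)"
    using nonneg by simp_all
  ultimately show "integral\<^sup>L \<mu> u = p * u a + (LINT s|lborel. u s * k s)"
    using ennreal_inj by blast
qed

text \<open>By independence the joint law of \<open>B\<close> and \<open>X\<close> is a product
  measure, so the probability of the planar event \<open>S\<close> is the integral of the measures
  of its sections at fixed \<open>s\<close>.\<close>

lemma (in prob_space) emeasure_distr_reflected_sum: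
  fixes B X :: "'a \<Rightarrow> real"
  assumes indep: "indep_var borel B borel X" and [measurable]: "A \<in> sets borel"
  shows "emeasure (distr M borel (\<lambda>\<omega>. max 0 (B \<omega> + X \<omega>))) A
    = (\<integral>\<^sup>+s. emeasure (distr M borel X) {x. max 0 (s + x) \<in> A} \<partial>distr M borel B)"
proof -
  have [measurable]: "B \<in> borel_measurable M" "X \<in> borel_measurable M"
    and joint: "distr M borel B \<Otimes>\<^sub>M distr M borel X = distr M (borel \<Otimes>\<^sub>M borel) (\<lambda>\<omega>. (B \<omega>, X \<omega>))"
    using indep unfolding indep_var_distribution_eq by auto
  interpret X: prob_space "distr M borel X"
    by (rule prob_space_distr) simp
  define S where "S = {p :: real \<times> real. max 0 (fst p + snd p) \<in> A}"
  have S: "S \<in> sets (borel \<Otimes>\<^sub>M borel)"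
  proof -
    have "(\<lambda>p :: real \<times> real. max 0 (fst p + snd p)) -` A \<inter> space (borel \<Otimes>\<^sub>M borel)
        \<in> sets (borel \<Otimes>\<^sub>M borel)"
      by (rule measurable_sets[of _ _ borel]) simp_all
    then show ?thesis
      by (simp add: S_def vimage_def space_pair_measure)
  qed
  have "emeasure (distr M borel (\<lambda>\<omega>. max 0 (B \<omega> + X \<omega>))) A
      = emeasure (distr M (borel \<Otimes>\<^sub>M borel) (\<lambda>\<omega>. (B \<omega>, X \<omega>))) S"
    using S by (subst (1 2) emeasure_distr) (auto simp: S_def intro!: arg_cong[where f="emeasure M"])
  also have "\<dots> = (\<integral>\<^sup>+s. emeasure (distr M borel X) (Pair s -` S) \<partial>distr M borel B)"
    unfolding joint[symmetric] by (rule X.emeasure_pair_measure_alt) (use S in simp)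
  finally show ?thesis
    by (simp add: S_def vimage_def)
qed

text \<open>This is the substitution y = s + x, which preserves Lebesgue measure.\<close>

lemma emeasure_density_translate:
  fixes f :: "real \<Rightarrow> ennreal"
  assumes [measurable]: "f \<in> borel_measurable borel" "A \<in> sets borel"
  shows "emeasure (density lborel f) {x. s + x \<in> A} = (\<integral>\<^sup>+y. f (y - s) * indicator A y \<partial>lborel)"
proof -
  have [measurable]: "{x. s + x \<in> A} \<in> sets borel"
    by measurable
  have "(\<integral>\<^sup>+y. f (y - s) * indicator A y \<partial>lborel) = (\<integral>\<^sup>+x. f x * indicator A (s + x) \<partial>lborel)"
    by (subst nn_integral_real_affine[where c = 1 and t = s]) auto
  then show ?thesis
    by (simp add: emeasure_density indicator_def)
qed

theorem mainTheorem4: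
  fixes M :: "'a measure"
    and X B :: "nat \<Rightarrow> 'a \<Rightarrow> real"
    and F\<^sub>X f\<^sub>X G g :: "real \<Rightarrow> real"
    and \<mu> :: "real measure"
    and p\<^sub>0 :: real
  assumes "prob_space M"
    and X_indep: "prob_space.indep_vars M (\<lambda>_. borel) X {1..}"
    and X_ident: "\<And>n. n \<ge> 1 \<Longrightarrow> distr M borel (X n) = distr M borel (X 1)"
    and X_drift: "integrable M (X 1)" "prob_space.expectation M (X 1) < 0"
    and F\<^sub>X: "F\<^sub>X = cdf (distr M borel (X 1))"
    and f\<^sub>X: "\<And>x. f\<^sub>X x \<ge> 0" "distributed M lborel (X 1) (\<lambda>x. ennreal (f\<^sub>X x))"
    and B_measurable: "\<And>n. B n \<in> borel_measurable M"
    and B_nonneg: "\<And>n \<omega>. \<omega> \<in> space M \<Longrightarrow> B n \<omega> \<ge> 0"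
    and B_Suc: "\<And>n \<omega>. \<omega> \<in> space M \<Longrightarrow> B (n + 1) \<omega> = max 0 (B n \<omega> + X (n + 1) \<omega>)"
    and B_indep: "\<And>n. prob_space.indep_var M borel (B n) borel (X (n + 1))"
    and stationary: "\<And>n. distr M borel (B n) = \<mu>"
    and G: "G = (\<lambda>b. measure \<mu> {0..b})"
    and p\<^sub>0: "p\<^sub>0 = measure \<mu> {0}"
    and g: "set_borel_measurable borel {0<..} g" "\<And>s. s > 0 \<Longrightarrow> g s \<ge> 0"
    and \<mu>_decomp: "\<And>A. A \<in> sets borel \<Longrightarrow>
      emeasure \<mu> A = ennreal p\<^sub>0 * emeasure (return borel 0) A
        + emeasure (density lborel (\<lambda>s. ennreal (g s) * indicator {0<..} s)) A"
  shows
    "(\<forall>b\<ge>0.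
        set_integrable \<mu> {0..} (\<lambda>s. F\<^sub>X (b - s)) \<and>
        G b = (LINT s:{0..}|\<mu>. F\<^sub>X (b - s)) \<and>
        set_integrable lborel {0<..} (\<lambda>s. F\<^sub>X (b - s) * g s) \<and>
        (LINT s:{0..}|\<mu>. F\<^sub>X (b - s))
          = p\<^sub>0 * F\<^sub>X b + (LINT s:{0<..}|lborel. F\<^sub>X (b - s) * g s)) \<and>
     (AE b in lborel. b > 0 \<longrightarrow>
        set_integrable lborel {0<..} (\<lambda>s. f\<^sub>X (b - s) * g s) \<and>
        g b = p\<^sub>0 * f\<^sub>X b + (LINT s:{0<..}|lborel. f\<^sub>X (b - s) * g s)) \<and>
     set_integrable lborel {0<..} g \<and>
     1 = p\<^sub>0 + (LINT b:{0<..}|lborel. g b)"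
proof -
  interpret prob_space M by fact
  define \<nu> where "\<nu> = distr M borel (X 1)"
  \<comment> \<open>Extension of \<open>g\<close> by zero: \<open>g\<close> is known to be
    measurable and nonnegative only on the open half-line, whereas \<open>k\<close> is so on all of
    the real line.\<close>
  define k where "k = (\<lambda>s. indicator {0<..} s * g s)"
  have X_meas: "X 1 \<in> borel_measurable M"
    using X_drift(1) by auto
  have k_meas [measurable]: "k \<in> borel_measurable borel"
    using g(1) by (simp add: k_def set_borel_measurable_def)
  have k_nonneg: "0 \<le> k s" for s
    using g(2) by (simp add: k_def indicator_def)
  have f_meas [measurable]: "f\<^sub>X \<in> borel_measurable borel"
  proof -
    \<comment> \<open>\<open>distributed\<close> gives measurability of the
      \<open>ennreal\<close>-valued density only; \<open>enn2real\<close> inverts the embedding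
      since the density is nonnegative.\<close>
    have "(\<lambda>x. enn2real (ennreal (f\<^sub>X x))) \<in> borel_measurable borel"
      using distributed_borel_measurable[OF f\<^sub>X(2)] by measurable
    then show ?thesis
      using f\<^sub>X(1) by simp
  qed
  have \<nu>_density: "\<nu> = density lborel (\<lambda>x. ennreal (f\<^sub>X x))"
    using distributed_distr_eq_density[OF f\<^sub>X(2)] distr_cong[of M M lborel borel "X 1" "X 1"]
    by (simp add: \<nu>_def)
  interpret \<nu>: real_distribution \<nu>
    unfolding \<nu>_def by (rule real_distribution_distr) (rule X_meas)
  interpret \<mu>: real_distribution \<mu>
    using stationary[of 0] real_distribution_distr[OF B_measurable[of 0]] by simp
  have p_nonneg: "0 \<le> p\<^sub>0"
    by (simp add: p\<^sub>0)
  have decomp: "emeasure \<mu> A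
      = ennreal p\<^sub>0 * emeasure (return borel 0) A + emeasure (density lborel (\<lambda>s. ennreal (k s))) A"
    if "A \<in> sets borel" for A
  proof -
    have "(\<lambda>s. ennreal (g s) * indicator {0<..} s) = (\<lambda>s. ennreal (k s))"
      by (auto simp: k_def indicator_def)
    then show ?thesis
      using \<mu>_decomp[OF that] by simp
  qed
  \<comment> \<open>Used three times below, with u(s) equal to \<open>f\<^sub>X (b - s)\<close>,
    \<open>F\<^sub>X (b - s)\<close> and the constant 1.\<close>
  have split: "integrable \<mu> u" "set_integrable lborel {0<..} (\<lambda>s. u s * g s)"
      "integral\<^sup>L \<mu> u = p\<^sub>0 * u 0 + (LINT s:{0<..}|lborel. u s * g s)"
    if "u \<in> borel_measurable borel" "\<And>s. 0 \<le> u s" "(\<integral>\<^sup>+s. ennreal (u s) \<partial>\<mu>) < \<infinity>" for u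
  proof -
    have k: "indicator {0<..} s *\<^sub>R (u s * g s) = u s * k s" for s
      by (simp add: k_def)
    note * = integral_atom_plus_density[of \<mu> p\<^sub>0 0 k u, OF \<mu>.events_eq_borel]
    show "integrable \<mu> u" "set_integrable lborel {0<..} (\<lambda>s. u s * g s)"
      "integral\<^sup>L \<mu> u = p\<^sub>0 * u 0 + (LINT s:{0<..}|lborel. u s * g s)"
      unfolding set_integrable_def set_lebesgue_integral_def k
      by (rule *; use that decomp k_meas k_nonneg p_nonneg in simp)+
  qed
  have AE_nonneg: "AE s in \<mu>. 0 \<le> s"
    unfolding stationary[of 0, symmetric] using B_nonneg B_measurable by (subst AE_distr_iff) auto
  \<comment> \<open>Stationarity enters here: \<open>B 0\<close> and \<open>B 1\<close> both have
    law \<mu>, and \<open>B 1\<close> is the reflected sum of the independent variables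
    \<open>B 0\<close> and \<open>X 1\<close>.\<close>
  have step: "emeasure \<mu> A = (\<integral>\<^sup>+s. emeasure \<nu> {x. max 0 (s + x) \<in> A} \<partial>\<mu>)"
    if "A \<in> sets borel" for A
  proof -
    have "\<mu> = distr M borel (\<lambda>\<omega>. max 0 (B 0 \<omega> + X 1 \<omega>))"
      unfolding stationary[of 1, symmetric] using B_Suc[of _ 0] by (intro distr_cong) auto
    then show ?thesis
      using emeasure_distr_reflected_sum[of "B 0" "X 1" A] B_indep[of 0] that stationary[of 0]
      by (simp add: \<nu>_def)
  qed
  have F_cdf: "F\<^sub>X = cdf \<nu>"
    by (simp add: F\<^sub>X \<nu>_def)
  have F_nonneg: "0 \<le> F\<^sub>X x" for x
    by (simp add: F_cdf \<nu>.cdf_nonneg)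
  have "mono F\<^sub>X"
    by (simp add: F_cdf mono_def \<nu>.cdf_nondecreasing)
  then have F_meas [measurable]: "F\<^sub>X \<in> borel_measurable borel"
    by (rule borel_measurable_mono)

  have part1: "set_integrable \<mu> {0..} (\<lambda>s. F\<^sub>X (b - s)) \<and>
        G b = (LINT s:{0..}|\<mu>. F\<^sub>X (b - s)) \<and>
        set_integrable lborel {0<..} (\<lambda>s. F\<^sub>X (b - s) * g s) \<and>
        (LINT s:{0..}|\<mu>. F\<^sub>X (b - s))
          = p\<^sub>0 * F\<^sub>X b + (LINT s:{0<..}|lborel. F\<^sub>X (b - s) * g s)" if "0 \<le> b" for b
  proof -
    define u where "u = (\<lambda>s. F\<^sub>X (b - s))"
    have u_meas [measurable]: "u \<in> borel_measurable borel"
      unfolding u_def by measurable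
    have u_nonneg: "0 \<le> u s" for s
      by (simp add: u_def F_nonneg)
    \<comment> \<open>For b \<ge> 0, truncating at 0 does not affect whether a value is at most
      b.\<close>
    have shift: "{x. max 0 (s + x) \<in> {0..b}} = {..b - s}" for s
      using that by auto
    have nn: "emeasure \<mu> {0..b} = (\<integral>\<^sup>+s. ennreal (u s) \<partial>\<mu>)"
      using step[of "{0..b}", unfolded shift]
      by (simp add: u_def F_cdf cdf_def \<nu>.emeasure_eq_measure)
    have fin: "(\<integral>\<^sup>+s. ennreal (u s) \<partial>\<mu>) < \<infinity>"
      unfolding nn[symmetric] by (simp add: \<mu>.emeasure_eq_measure)
    note u_split = split[OF u_meas u_nonneg fin]
    \<comment> \<open>The restriction to the closed half-line costs nothing, as \<mu> gives no mass
      to negative numbers.\<close>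
    have "(LINT s:{0..}|\<mu>. u s) = integral\<^sup>L \<mu> u"
      unfolding set_lebesgue_integral_def
      by (rule integral_cong_AE) (use AE_nonneg in auto)
    moreover have "set_integrable \<mu> {0..} u"
      unfolding set_integrable_def using u_split(1) by (intro integrable_mult_indicator) auto
    moreover have "G b = integral\<^sup>L \<mu> u"
      using nn nn_integral_eq_integral[OF u_split(1)] u_nonneg
      by (simp add: G \<mu>.emeasure_eq_measure)
    ultimately show ?thesis
      using u_split by (simp add: u_def)
  qed

  \<comment> \<open>Candidate density on the open half-line. It takes values in
    \<open>ennreal\<close> because at an individual point the integral could be infinite.\<close>
  define h where "h = (\<lambda>y. \<integral>\<^sup>+s. ennreal (f\<^sub>X (y - s)) \<partial>\<mu>)"
  have h_meas [measurable]: "h \<in> borel_measurable borel"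
    unfolding h_def by measurable
  have "AE b in lborel. ennreal (k b) = h b * indicator {0<..} b"
  proof (rule sigma_finite_measure.density_unique[OF lborel.sigma_finite_measure_axioms])
    show "density lborel (\<lambda>b. ennreal (k b)) = density lborel (\<lambda>b. h b * indicator {0<..} b)"
    proof (rule measure_eqI)
      fix A :: "real set" assume "A \<in> sets (density lborel (\<lambda>b. ennreal (k b)))"
      then have A [measurable]: "A \<in> sets borel" by simp
      \<comment> \<open>Intersecting with the open half-line removes 0, so the atom contributes
        nothing to the measure of \<open>A'\<close> and \<mu> agrees there with its density
        part.\<close>
      define A' where "A' = A \<inter> {0<..}"
      have A' [measurable]: "A' \<in> sets borel"
        by (simp add: A'_def)
      have "emeasure (density lborel (\<lambda>b. ennreal (k b))) A
          = emeasure (density lborel (\<lambda>b. ennreal (k b))) A'"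
      proof -
        have "ennreal (k b) * indicator A b = ennreal (k b) * indicator A' b" for b
          by (simp add: A'_def k_def indicator_def)
        then show ?thesis by (simp add: emeasure_density)
      qed
      also have "\<dots> = emeasure \<mu> A'"
        using decomp[OF A'] by (simp add: A'_def)
      also have "\<dots> = (\<integral>\<^sup>+s. emeasure \<nu> {x. max 0 (s + x) \<in> A'} \<partial>\<mu>)"
        by (rule step) simp
      also have "\<dots> = (\<integral>\<^sup>+s. emeasure \<nu> {x. s + x \<in> A'} \<partial>\<mu>)"
      proof -
        \<comment> \<open>If t \<le> 0, then neither t nor its truncation 0 lies in
          \<open>A'\<close>; if t > 0, truncation leaves t unchanged.\<close>
        have "max 0 t \<in> A' \<longleftrightarrow> t \<in> A'" for t
          by (auto simp: A'_def max_def)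
        then show ?thesis by simp
      qed
      also have "\<dots> = (\<integral>\<^sup>+s. \<integral>\<^sup>+y. ennreal (f\<^sub>X (y - s)) * indicator A' y \<partial>lborel \<partial>\<mu>)"
        unfolding \<nu>_density by (subst emeasure_density_translate) simp_all
      also have "\<dots> = (\<integral>\<^sup>+y. \<integral>\<^sup>+s. ennreal (f\<^sub>X (y - s)) * indicator A' y \<partial>\<mu> \<partial>lborel)"
      proof -
        interpret pair_sigma_finite \<mu> lborel ..
        show ?thesis
          \<comment> \<open>The integrand is nonnegative, so the exchange needs only joint
            measurability and the sigma-finiteness of both measures.\<close>
          by (rule Fubini'[symmetric]) measurable
      qed
      also have "\<dots> = (\<integral>\<^sup>+y. h y * indicator A' y \<partial>lborel)"
        unfolding h_def by (subst nn_integral_multc) auto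
      also have "\<dots> = emeasure (density lborel (\<lambda>b. h b * indicator {0<..} b)) A"
        by (auto simp: emeasure_density A'_def indicator_def intro!: nn_integral_cong)
      finally show "emeasure (density lborel (\<lambda>b. ennreal (k b))) A
        = emeasure (density lborel (\<lambda>b. h b * indicator {0<..} b)) A" .
    qed simp
  qed simp_all
  then have part2: "AE b in lborel. b > 0 \<longrightarrow>
        set_integrable lborel {0<..} (\<lambda>s. f\<^sub>X (b - s) * g s) \<and>
        g b = p\<^sub>0 * f\<^sub>X b + (LINT s:{0<..}|lborel. f\<^sub>X (b - s) * g s)"
  proof (eventually_elim, intro impI)
    fix b :: real assume eq: "ennreal (k b) = h b * indicator {0<..} b" and "0 < b"
    define u where "u = (\<lambda>s. f\<^sub>X (b - s))"
    have u_meas [measurable]: "u \<in> borel_measurable borel"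
      unfolding u_def by measurable
    have u_nonneg: "0 \<le> u s" for s
      by (simp add: u_def f\<^sub>X(1))
    \<comment> \<open>At every b > 0 outside the exceptional null set, the integral
      \<open>h b\<close> equals the real number \<open>g b\<close> and is therefore finite. This is
      what gives integrability of the convolution integrand at such b.\<close>
    have nn: "(\<integral>\<^sup>+s. ennreal (u s) \<partial>\<mu>) = ennreal (g b)"
      using eq \<open>0 < b\<close> by (simp add: h_def u_def k_def)
    have fin: "(\<integral>\<^sup>+s. ennreal (u s) \<partial>\<mu>) < \<infinity>"
      by (simp add: nn)
    note u_split = split[OF u_meas u_nonneg fin]
    have "g b = integral\<^sup>L \<mu> u"
      using nn nn_integral_eq_integral[OF u_split(1)] u_nonneg g(2)[OF \<open>0 < b\<close>] by simp
    then show "set_integrable lborel {0<..} (\<lambda>s. f\<^sub>X (b - s) * g s) \<and>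
        g b = p\<^sub>0 * f\<^sub>X b + (LINT s:{0<..}|lborel. f\<^sub>X (b - s) * g s)"
      using u_split by (simp add: u_def)
  qed

  \<comment> \<open>With u = 1 the splitting formula computes the total mass of \<mu>, which is
    1.\<close>
  have part3: "set_integrable lborel {0<..} g \<and> 1 = p\<^sub>0 + (LINT b:{0<..}|lborel. g b)"
    using split(2,3)[of "\<lambda>_. 1"] \<mu>.prob_space
    by (simp add: \<mu>.emeasure_eq_measure)
  show ?thesis
    using part1 part2 part3 by blast
qed

end
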